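(* For every graph $\Gamma$ there exists a graph $\Gamma'$ such that $\Gamma'$ admits a partial orientation as a quasi-transitive mixed graph and $\Gamma$ is an induced subgraph of $\Gamma'$.
   Context: A mixed graph has a vertex set, a set of (undirected) edges and a set of arcs, with at most one edge or arc between any pair of vertices. A partial orientation of a graph $\Gamma$ is a mixed graph obtained from $\Gamma$ by orienting some (possibly none or all) of its edges as arcs. A $2$-dipath is a directed path $uvw$ consisting of arcs $u\to v$ and $v\to w$; it is induced if $u$ and $w$ are not joined by an edge or arc. A mixed graph $H$ is quasi-transitive when (1) $H$ has no induced $2$-dipath, and (2) for every edge $uv$ of $H$ there is a vertex $w$ such that $uwv$ or $vwu$ is a $2$-dipath. *)

theory Defs
  imports Main
begin

record 'a ugraph =
  verts :: "'a set"
  edges :: "'a set set"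

definition simple_graph :: "('a, 'b) ugraph_scheme \<Rightarrow> bool" where
  "simple_graph G \<longleftrightarrow>
     (\<forall>e\<in>edges G. \<exists>u v. u \<in> verts G \<and> v \<in> verts G \<and> u \<noteq> v \<and> e = {u, v})"

definition induced_subgraph :: "'a ugraph \<Rightarrow> 'a ugraph \<Rightarrow> bool" where
  "induced_subgraph H G \<longleftrightarrow>
     verts H \<subseteq> verts G \<and> edges H = {e \<in> edges G. e \<subseteq> verts H}"

definition relabel :: "('a \<Rightarrow> 'b) \<Rightarrow> 'a ugraph \<Rightarrow> 'b ugraph" where
  "relabel f G = \<lparr>verts = f ` verts G, edges = (\<lambda>e. f ` e) ` edges G\<rparr>"

text \<open>In a mixed graph, \<open>edges\<close> holds only the undirected edges;
  \<open>(u, v) \<in> arcs M\<close> is the arc from \<open>u\<close> to \<open>v\<close>.\<close>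

record 'a mgraph = "'a ugraph" +
  arcs :: "('a \<times> 'a) set"

definition mixed_graph :: "'a mgraph \<Rightarrow> bool" where
  "mixed_graph M \<longleftrightarrow>
     simple_graph M \<and>
     (\<forall>u v. (u, v) \<in> arcs M \<longrightarrow>
        u \<in> verts M \<and> v \<in> verts M \<and> u \<noteq> v \<and>
        {u, v} \<notin> edges M \<and> (v, u) \<notin> arcs M)"

definition partial_orientation :: "'a mgraph \<Rightarrow> 'a ugraph \<Rightarrow> bool" where
  "partial_orientation M G \<longleftrightarrow>
     mixed_graph M \<and> verts M = verts G \<and>
     edges G = edges M \<union> {{u, v} | u v. (u, v) \<in> arcs M}"

definition joined :: "'a mgraph \<Rightarrow> 'a \<Rightarrow> 'a \<Rightarrow> bool" where
  "joined M u v \<longleftrightarrow> {u, v} \<in> edges M \<or> (u, v) \<in> arcs M \<or> (v, u) \<in> arcs M"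

definition two_dipath :: "'a mgraph \<Rightarrow> 'a \<Rightarrow> 'a \<Rightarrow> 'a \<Rightarrow> bool" where
  "two_dipath M u v w \<longleftrightarrow> (u, v) \<in> arcs M \<and> (v, w) \<in> arcs M \<and> u \<noteq> w"

definition induced_two_dipath :: "'a mgraph \<Rightarrow> 'a \<Rightarrow> 'a \<Rightarrow> 'a \<Rightarrow> bool" where
  "induced_two_dipath M u v w \<longleftrightarrow> two_dipath M u v w \<and> \<not> joined M u w"

definition quasi_transitive :: "'a mgraph \<Rightarrow> bool" where
  "quasi_transitive M \<longleftrightarrow>
     mixed_graph M \<and>
     (\<nexists>u v w. induced_two_dipath M u v w) \<and>
     (\<forall>u v. {u, v} \<in> edges M \<longrightarrow> (\<exists>w. two_dipath M u w v \<or> two_dipath M v w u))"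

end

theory Submission
  imports Defs
begin

text \<open>Replace every edge \<open>uv\<close> of \<open>\<Gamma>\<close> by two directed paths \<open>u \<rightarrow> w\<^bsub>uv\<^esub> \<rightarrow> v\<close> and \<open>v \<rightarrow> w\<^bsub>vu\<^esub> \<rightarrow> u\<close>
  through new vertices, and then join the ends of every induced 2-dipath by an undirected edge.
  The second step turns any oriented graph into a quasi-transitive mixed graph: it adds no arcs,
  hence no 2-dipaths, and every edge is witnessed by a 2-dipath that it closes. As no arc joins two
  vertices of \<open>\<Gamma>\<close>, such vertices end up adjacent exactly when some 2-dipath runs between them,
  that is, when they were adjacent in \<open>\<Gamma>\<close>.\<close>

lemma simple_graph_edgeD:
  assumes "simple_graph G" "{u, v} \<in> edges G"
  shows "u \<in> verts G" "v \<in> verts G" "u \<noteq> v"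
proof -
  obtain a b where "a \<in> verts G" "b \<in> verts G" "a \<noteq> b" "{u, v} = {a, b}"
    using assms unfolding simple_graph_def by blast
  then show "u \<in> verts G" "v \<in> verts G" "u \<noteq> v"
    by (auto simp: doubleton_eq_iff)
qed

lemma simple_graph_no_loop: "simple_graph G \<Longrightarrow> {u} \<notin> edges G"
  using simple_graph_edgeD(3)[of G u u] by auto

lemma simple_graph_add_edges:
  assumes G: "simple_graph G"
    and verts: "verts H = verts G"
    and edges: "edges H = edges G \<union> {{u, v} | u v. R u v}"
    and R: "\<And>u v. R u v \<Longrightarrow> u \<in> verts G \<and> v \<in> verts G \<and> u \<noteq> v"
  shows "simple_graph H"
  unfolding simple_graph_def
proof
  fix e
  assume "e \<in> edges H"
  then consider (old) "e \<in> edges G" | (new) u v where "R u v" "e = {u, v}"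
    using edges by blast
  then show "\<exists>u v. u \<in> verts H \<and> v \<in> verts H \<and> u \<noteq> v \<and> e = {u, v}"
  proof cases
    case old
    then show ?thesis
      using G by (simp add: simple_graph_def verts)
  next
    case new
    then show ?thesis
      using R[of u v] verts by blast
  qed
qed

lemma induced_subgraph_relabelI:
  assumes G: "simple_graph G" and H: "simple_graph H"
    and verts: "f ` verts G \<subseteq> verts H"
    and adjacent_iff: "\<And>u v. u \<in> verts G \<Longrightarrow> v \<in> verts G \<Longrightarrow>
      {f u, f v} \<in> edges H \<longleftrightarrow> {u, v} \<in> edges G"
  shows "induced_subgraph (relabel f G) H"
proof -
  have "(\<lambda>e. f ` e) ` edges G = {e \<in> edges H. e \<subseteq> f ` verts G}"
  proof (intro equalityI subsetI)
    fix e
    assume "e \<in> (\<lambda>e. f ` e) ` edges G"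
    then obtain u v where "{u, v} \<in> edges G" "u \<in> verts G" "v \<in> verts G" "e = {f u, f v}"
      using G by (auto simp: simple_graph_def)
    then show "e \<in> {e \<in> edges H. e \<subseteq> f ` verts G}"
      using adjacent_iff by simp
  next
    fix e
    assume "e \<in> {e \<in> edges H. e \<subseteq> f ` verts G}"
    moreover from this obtain a b where "e = {a, b}"
      using H by (auto simp: simple_graph_def)
    ultimately obtain u v
      where "u \<in> verts G" "v \<in> verts G" "e = f ` {u, v}" "{f u, f v} \<in> edges H"
      by auto
    then show "e \<in> (\<lambda>e. f ` e) ` edges G"
      using adjacent_iff by blast
  qed
  with verts show ?thesis
    by (simp add: induced_subgraph_def relabel_def)
qed

definition underlying_graph :: "'a mgraph \<Rightarrow> 'a ugraph" where
  "underlying_graph M =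
     \<lparr>verts = verts M, edges = edges M \<union> {{u, v} | u v. (u, v) \<in> arcs M}\<rparr>"

lemma verts_underlying_graph [simp]: "verts (underlying_graph M) = verts M"
  by (simp add: underlying_graph_def)

lemma adjacent_underlying_graph_iff [simp]:
  "{u, v} \<in> edges (underlying_graph M) \<longleftrightarrow> joined M u v"
  by (auto simp: underlying_graph_def joined_def doubleton_eq_iff)

lemma partial_orientation_underlying_graph:
  "mixed_graph M \<Longrightarrow> partial_orientation M (underlying_graph M)"
  by (simp add: partial_orientation_def underlying_graph_def)

lemma partial_orientation_imp_simple_graph:
  assumes "partial_orientation M G"
  shows "simple_graph G"
proof (rule simple_graph_add_edges)
  show "simple_graph M" "verts G = verts M"
    "edges G = edges M \<union> {{u, v} | u v. (u, v) \<in> arcs M}"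
    using assms by (simp_all add: partial_orientation_def mixed_graph_def)
  show "u \<in> verts M \<and> v \<in> verts M \<and> u \<noteq> v" if "(u, v) \<in> arcs M" for u v
    using that assms by (auto simp: partial_orientation_def mixed_graph_def)
qed

definition close_two_dipaths :: "'a mgraph \<Rightarrow> 'a mgraph" where
  "close_two_dipaths M = M\<lparr>edges := edges M \<union> {{u, w} | u w. \<exists>v. induced_two_dipath M u v w}\<rparr>"

lemma verts_close_two_dipaths [simp]: "verts (close_two_dipaths M) = verts M"
  by (simp add: close_two_dipaths_def)

lemma arcs_close_two_dipaths [simp]: "arcs (close_two_dipaths M) = arcs M"
  by (simp add: close_two_dipaths_def)

lemma two_dipath_close_two_dipaths [simp]: "two_dipath (close_two_dipaths M) = two_dipath M"
  by (simp add: two_dipath_def fun_eq_iff)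

lemma edge_close_two_dipaths_iff:
  "{u, w} \<in> edges (close_two_dipaths M) \<longleftrightarrow>
     {u, w} \<in> edges M \<or> (\<exists>v. induced_two_dipath M u v w \<or> induced_two_dipath M w v u)"
  by (auto simp: close_two_dipaths_def doubleton_eq_iff)

lemma joined_commute: "joined M u v \<longleftrightarrow> joined M v u"
  by (auto simp: joined_def insert_commute)

lemma joined_close_two_dipaths_iff:
  "joined (close_two_dipaths M) u w \<longleftrightarrow>
     joined M u w \<or> (\<exists>v. two_dipath M u v w \<or> two_dipath M w v u)"
proof -
  have "joined (close_two_dipaths M) u w \<longleftrightarrow>
      joined M u w \<or> (\<exists>v. induced_two_dipath M u v w \<or> induced_two_dipath M w v u)"
    by (auto simp: joined_def edge_close_two_dipaths_iff)
  then show ?thesis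
    using joined_commute[of M u w] by (auto simp: induced_two_dipath_def)
qed

lemma mixed_graph_close_two_dipaths:
  assumes "mixed_graph M"
  shows "mixed_graph (close_two_dipaths M)"
proof -
  have "simple_graph (close_two_dipaths M)"
  proof (rule simple_graph_add_edges)
    show "simple_graph M" "verts (close_two_dipaths M) = verts M"
      "edges (close_two_dipaths M) = edges M \<union> {{u, w} | u w. \<exists>v. induced_two_dipath M u v w}"
      using assms by (simp_all add: mixed_graph_def close_two_dipaths_def)
    show "u \<in> verts M \<and> w \<in> verts M \<and> u \<noteq> w" if "\<exists>v. induced_two_dipath M u v w" for u w
      using that assms by (auto simp: induced_two_dipath_def two_dipath_def mixed_graph_def)
  qed
  moreover have "{u, v} \<notin> edges (close_two_dipaths M)" if "(u, v) \<in> arcs M" for u v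
    using that assms
    by (auto simp: edge_close_two_dipaths_iff induced_two_dipath_def joined_def mixed_graph_def)
  ultimately show ?thesis
    using assms by (simp add: mixed_graph_def)
qed

lemma quasi_transitive_close_two_dipaths:
  assumes "mixed_graph M"
    and "\<And>u v. {u, v} \<in> edges M \<Longrightarrow> \<exists>w. two_dipath M u w v \<or> two_dipath M v w u"
  shows "quasi_transitive (close_two_dipaths M)"
  unfolding quasi_transitive_def
proof (intro conjI allI impI)
  show "mixed_graph (close_two_dipaths M)"
    using assms(1) by (rule mixed_graph_close_two_dipaths)
  show "\<nexists>u v w. induced_two_dipath (close_two_dipaths M) u v w"
    by (auto simp: induced_two_dipath_def joined_close_two_dipaths_iff)
  show "\<exists>w. two_dipath (close_two_dipaths M) u w v \<or> two_dipath (close_two_dipaths M) v w u"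
    if "{u, v} \<in> edges (close_two_dipaths M)" for u v
    using that assms(2) by (auto simp: edge_close_two_dipaths_iff induced_two_dipath_def)
qed

text \<open>\<open>Inr [u, v]\<close> is the vertex \<open>w\<^bsub>uv\<^esub>\<close>; since \<open>{u, v} = {v, u}\<close>, every edge yields both
  \<open>w\<^bsub>uv\<^esub>\<close> and \<open>w\<^bsub>vu\<^esub>\<close>.\<close>

definition dipath_subdivision :: "'a ugraph \<Rightarrow> ('a + 'a list) mgraph" where
  "dipath_subdivision G =
     \<lparr>verts = Inl ` verts G \<union> {Inr [u, v] | u v. {u, v} \<in> edges G},
      edges = {},
      arcs = {(Inl u, Inr [u, v]) | u v. {u, v} \<in> edges G} \<union>
             {(Inr [u, v], Inl v) | u v. {u, v} \<in> edges G}\<rparr>"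

lemma edges_dipath_subdivision [simp]: "edges (dipath_subdivision G) = {}"
  by (simp add: dipath_subdivision_def)

lemma mixed_graph_dipath_subdivision:
  assumes "simple_graph G"
  shows "mixed_graph (dipath_subdivision G)"
proof -
  have "simple_graph (dipath_subdivision G)"
    by (simp add: simple_graph_def)
  moreover have "a \<in> verts (dipath_subdivision G) \<and> b \<in> verts (dipath_subdivision G) \<and>
      a \<noteq> b \<and> (b, a) \<notin> arcs (dipath_subdivision G)"
    if "(a, b) \<in> arcs (dipath_subdivision G)" for a b
    using that simple_graph_edgeD(1,2)[OF assms] simple_graph_no_loop[OF assms]
    by (auto simp: dipath_subdivision_def)
  ultimately show ?thesis
    by (simp add: mixed_graph_def)
qed

lemma finite_verts_dipath_subdivision:
  assumes "simple_graph G" "finite (verts G)"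
  shows "finite (verts (dipath_subdivision G))"
proof (rule finite_subset)
  show "verts (dipath_subdivision G) \<subseteq>
      Inl ` verts G \<union> (\<lambda>(u, v). Inr [u, v]) ` (verts G \<times> verts G)"
    using simple_graph_edgeD[OF assms(1)] by (auto simp: dipath_subdivision_def)
qed (use assms in simp)

lemma not_joined_dipath_subdivision_Inl: "\<not> joined (dipath_subdivision G) (Inl u) (Inl v)"
  by (simp add: joined_def dipath_subdivision_def)

lemma two_dipath_dipath_subdivision_Inl_iff:
  assumes "simple_graph G"
  shows "(\<exists>w. two_dipath (dipath_subdivision G) (Inl u) w (Inl v)) \<longleftrightarrow> {u, v} \<in> edges G"
  using simple_graph_no_loop[OF assms]
  by (auto simp: two_dipath_def dipath_subdivision_def)

lemma joined_close_two_dipaths_dipath_subdivision_Inl_iff: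
  assumes "simple_graph G"
  shows "joined (close_two_dipaths (dipath_subdivision G)) (Inl u) (Inl v) \<longleftrightarrow> {u, v} \<in> edges G"
  using two_dipath_dipath_subdivision_Inl_iff[OF assms]
  by (simp add: joined_close_two_dipaths_iff not_joined_dipath_subdivision_Inl
      ex_disj_distrib insert_commute)

theorem theorem2p1:
  fixes \<Gamma> :: "'a ugraph"
  assumes "simple_graph \<Gamma>"
  shows "\<exists>\<Gamma>' :: ('a + 'a list) ugraph.
           simple_graph \<Gamma>' \<and>
           (finite (verts \<Gamma>) \<longrightarrow> finite (verts \<Gamma>')) \<and>
           (\<exists>M. partial_orientation M \<Gamma>' \<and> quasi_transitive M) \<and>
           induced_subgraph (relabel Inl \<Gamma>) \<Gamma>'"
proof (intro exI conjI impI)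
  let ?S = "dipath_subdivision \<Gamma>"
  let ?M = "close_two_dipaths ?S"
  have mixed: "mixed_graph ?S"
    using assms by (rule mixed_graph_dipath_subdivision)
  then show "partial_orientation ?M (underlying_graph ?M)"
    by (intro partial_orientation_underlying_graph mixed_graph_close_two_dipaths)
  then show simple: "simple_graph (underlying_graph ?M)"
    by (rule partial_orientation_imp_simple_graph)
  show "quasi_transitive ?M"
    using mixed by (rule quasi_transitive_close_two_dipaths) simp
  show "finite (verts (underlying_graph ?M))" if "finite (verts \<Gamma>)"
    using finite_verts_dipath_subdivision[OF assms that] by simp
  show "induced_subgraph (relabel Inl \<Gamma>) (underlying_graph ?M)"
    using assms simple
  proof (rule induced_subgraph_relabelI)
    show "Inl ` verts \<Gamma> \<subseteq> verts (underlying_graph ?M)"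
      by (simp add: dipath_subdivision_def)
  qed (simp add: joined_close_two_dipaths_dipath_subdivision_Inl_iff[OF assms])
qed

end
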